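(* Consider the $L$-layer linear self-attention transformer with layer parameters $b_l\in\mathbb{R}^{d+1}$ and $A_l=-\begin{bmatrix}\bar A_l\\ a_l^\top\end{bmatrix}$, where $\bar A_l\in\mathbb{R}^{d\times d}$ and $a_l\in\mathbb{R}^d$ (see context), applied to a prompt $Z_0$ with in-context examples $(x_j,y_j)$, $1\le j\le n$, and query $x_{n+1}$. The forward pass of the transformer is equivalent to optimizing two groups of objectives $R_1,R_2:\mathbb{R}^d\to\mathbb{R}^{d+1}$, in the following sense. Let $y_{n+1}^{(l)}=[Z_l]_{d+1,n+1}$ be the bottom-right entry of the $l$th layer output. Then $$y_{n+1}^{(l)}=\langle w_l,x_{n+1}\rangle,$$ where $w_l\in\mathbb{R}^d$ is defined iteratively by $w_0=0$ and $$w_{l+1}^\top=w_l^\top-b_l^\top\left(\nabla R_1(w_l)\,\bar A_l+\nabla R_2(w_l)\begin{bmatrix}0_{(d-1)\times d}\\ a_l^\top\end{bmatrix}\right),$$ with $$R_1(w)=\frac1n\sum_{j=1}^n\begin{bmatrix}-\langle w,x_j\rangle x_j\\ \frac12\big(y_j-\langle w,x_j\rangle\big)^2\end{bmatrix},\qquad R_2(w)=\frac1n\sum_{j=1}^n\begin{bmatrix}\Big(-w_d\big(y_j-\langle w_{:d-1},x_{j,:d-1}\rangle\big)+\frac{w_d^2}{2}x_{j,d}\Big)x_j\\ \rho_j(w)\end{bmatrix},$$ $$\rho_j(w)=\begin{cases}\dfrac{1}{3x_{j,d}}\big(y_j-w^\top x_j\big)^3,& x_{j,d}\ne0,\\[6pt]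 -\big(y_j-\langle w_{:d-1},x_{j,:d-1}\rangle\big)^2w_d,& x_{j,d}=0.\end{cases}$$
   Context: Here $d,n,L\ge1$. Prompt: $x_1,\dots,x_{n+1}\in\mathcal{S}^d$, $y_1,\dots,y_n\in\mathcal{S}$ with $\mathcal{S}\subset\mathbb{R}$ a finite state space (e.g. $\mathcal S=\{0,1\}$), and $$Z_0=\begin{bmatrix}x_1&\cdots&x_n&x_{n+1}\\ y_1&\cdots&y_n&0\end{bmatrix}\in\mathbb{R}^{(d+1)\times(n+1)},\qquad M=\begin{bmatrix}I_n&0\\0&0\end{bmatrix}\in\mathbb{R}^{(n+1)\times(n+1)}.$$ The result holds for any given prompt instance; no expectation is taken. Transformer: for $l=0,\dots,L-1$, $Z_{l+1}=Z_l+\frac1nP_lZ_lM(Z_l^\top Q_lZ_l)$, where $$P_l=\begin{bmatrix}0_{d\times(d+1)}\\ b_l^\top\end{bmatrix},\qquad Q_l=\begin{bmatrix}A_l&0_{d+1}\end{bmatrix}=-\begin{bmatrix}\bar A_l&0_d\\ a_l^\top&0\end{bmatrix}\in\mathbb{R}^{(d+1)\times(d+1)}.$$ Notation: $w_d$ and $x_{j,d}$ are the $d$th entries of $w$ and $x_j$; $w_{:d-1}$ and $x_{j,:d-1}$ are their first $d-1$ entries. For $R:\mathbb{R}^d\to\mathbb{R}^{d+1}$, $\nabla R(w)\in\mathbb{R}^{(d+1)\times d}$ denotes the Jacobian matrix, with $(i,k)$ entry $\partial R_i/\partial w_k$.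
   Formalization: The identity is proved with a minus sign, y_{n+1}^{(l)} = -<w_l, x_{n+1}>; the printed sign fails for d=n=L=1, x_1=x_2=y_1=1, b_0=(0,1), \bar A_0=1, a_0=0, where y_2^{(1)}=-1 but <w_1,x_2>=1. *)

theory Defs
  imports
    "HOL-Analysis.Derivative"
    "Jordan_Normal_Form.Matrix"
begin

unbundle no vec_syntax
unbundle no inner_syntax

hide_type (open) Finite_Cartesian_Product.vec
hide_const (open) Finite_Cartesian_Product.vec Finite_Cartesian_Product.row

text \<open>
  Prompts are given by families \<open>x\<close>, \<open>y\<close> that are indexed from 1 as on paper, with
  \<open>x (n + 1)\<close> the query.  Entries of vectors and matrices are indexed from 0, so the
  \<open>d\<close>-th entry of \<open>w\<close> is \<open>w $ (d - 1)\<close> and the bottom-right entry of a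
  \<open>(d + 1) \<times> (n + 1)\<close> matrix \<open>Z\<close> is \<open>Z $$ (d, n)\<close>.
\<close>

definition prompt :: "nat \<Rightarrow> nat \<Rightarrow> (nat \<Rightarrow> real vec) \<Rightarrow> (nat \<Rightarrow> real) \<Rightarrow> real mat" where
  "prompt d n x y = mat (d + 1) (n + 1)
     (\<lambda>(i, j). if i < d then x (j + 1) $ i else if j < n then y (j + 1) else 0)"

definition mask :: "nat \<Rightarrow> real mat" where
  "mask n = four_block_mat (1\<^sub>m n) (0\<^sub>m n 1) (0\<^sub>m 1 n) (0\<^sub>m 1 1)"

definition P_mat :: "nat \<Rightarrow> real vec \<Rightarrow> real mat" where
  "P_mat d b = 0\<^sub>m d (d + 1) @\<^sub>r mat_of_row b"

definition A_mat :: "real mat \<Rightarrow> real vec \<Rightarrow> real mat" where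
  "A_mat Abar a = - (Abar @\<^sub>r mat_of_row a)"

text \<open>
  The lower blocks of \<open>Q_mat\<close> have no rows: \<open>Q = [A 0]\<close> with \<open>A\<close> of size
  \<open>(d + 1) \<times> d\<close>.
\<close>

definition Q_mat :: "nat \<Rightarrow> real mat \<Rightarrow> real vec \<Rightarrow> real mat" where
  "Q_mat d Abar a =
     four_block_mat (A_mat Abar a) (0\<^sub>m (d + 1) 1) (0\<^sub>m 0 d) (0\<^sub>m 0 1)"

primrec transformer :: "nat \<Rightarrow> nat \<Rightarrow> (nat \<Rightarrow> real vec) \<Rightarrow> (nat \<Rightarrow> real) \<Rightarrow>
    (nat \<Rightarrow> real vec) \<Rightarrow> (nat \<Rightarrow> real mat) \<Rightarrow> (nat \<Rightarrow> real vec) \<Rightarrow> nat \<Rightarrow> real mat" where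
  "transformer d n x y b Abar a 0 = prompt d n x y"
| "transformer d n x y b Abar a (Suc l) =
     (let Z = transformer d n x y b Abar a l in
      Z + (1 / real n) \<cdot>\<^sub>m
        (P_mat d (b l) * Z * mask n * (Z\<^sup>T * Q_mat d (Abar l) (a l) * Z)))"

text \<open>
  The residuals \<open>y j - w \<bullet> x j\<close> in \<open>R1\<close> and \<open>R2\<close> are the entries of the last row of
  the layer output in the columns of the examples.  The query column starts with \<open>0\<close> in
  place of \<open>y j\<close>, so its last entry is \<open>- (w \<bullet> x (n + 1))\<close>, with a minus sign.
\<close>

definition R1 :: "nat \<Rightarrow> nat \<Rightarrow> (nat \<Rightarrow> real vec) \<Rightarrow> (nat \<Rightarrow> real) \<Rightarrow> real vec \<Rightarrow> real vec" where
  "R1 d n x y w = vec (d + 1) (\<lambda>i. 1 / real n * (\<Sum>j = 1..n.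
     if i < d then - (w \<bullet> x j) * x j $ i
     else 1 / 2 * (y j - w \<bullet> x j)\<^sup>2))"

definition rho :: "nat \<Rightarrow> real vec \<Rightarrow> real \<Rightarrow> real vec \<Rightarrow> real" where
  "rho d xj yj w =
     (if xj $ (d - 1) \<noteq> 0
      then 1 / (3 * xj $ (d - 1)) * (yj - w \<bullet> xj) ^ 3
      else - ((yj - vec_first w (d - 1) \<bullet> vec_first xj (d - 1))\<^sup>2) * w $ (d - 1))"

definition R2 :: "nat \<Rightarrow> nat \<Rightarrow> (nat \<Rightarrow> real vec) \<Rightarrow> (nat \<Rightarrow> real) \<Rightarrow> real vec \<Rightarrow> real vec" where
  "R2 d n x y w = vec (d + 1) (\<lambda>i. 1 / real n * (\<Sum>j = 1..n.
     if i < d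
     then (- w $ (d - 1) * (y j - vec_first w (d - 1) \<bullet> vec_first (x j) (d - 1))
           + (w $ (d - 1))\<^sup>2 / 2 * x j $ (d - 1)) * x j $ i
     else rho d (x j) (y j) w))"

text \<open>
  Entry \<open>(i, k)\<close> is the partial derivative of the component \<open>i\<close> in the coordinate
  \<open>k\<close>.  \<open>deriv\<close> is meaningful only where that derivative exists; all components of
  \<open>R1\<close> and \<open>R2\<close> are polynomials in the entries of \<open>w\<close>.
\<close>

definition jacobian_mat :: "nat \<Rightarrow> nat \<Rightarrow> (real vec \<Rightarrow> real vec) \<Rightarrow> real vec \<Rightarrow> real mat" where
  "jacobian_mat m d R w =
     mat m d (\<lambda>(i, k). deriv (\<lambda>t. R (w |\<^sub>v k \<mapsto> t) $ i) (w $ k))"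

primrec weights :: "nat \<Rightarrow> nat \<Rightarrow> (nat \<Rightarrow> real vec) \<Rightarrow> (nat \<Rightarrow> real) \<Rightarrow>
    (nat \<Rightarrow> real vec) \<Rightarrow> (nat \<Rightarrow> real mat) \<Rightarrow> (nat \<Rightarrow> real vec) \<Rightarrow> nat \<Rightarrow> real vec" where
  "weights d n x y b Abar a 0 = 0\<^sub>v d"
| "weights d n x y b Abar a (Suc l) =
     (let w = weights d n x y b Abar a l in
      row (mat_of_row w - mat_of_row (b l) *
        (jacobian_mat (d + 1) d (R1 d n x y) w * Abar l
         + jacobian_mat (d + 1) d (R2 d n x y) w * (0\<^sub>m (d - 1) d @\<^sub>r mat_of_row (a l)))) 0)"

end

theory Submission
  imports Defs
begin

text \<open>
  Column \<open>j\<close> of the layer output \<open>Z\<^sub>l\<close> keeps the covariate \<open>x j\<close>, and its last entry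
  is the residual \<open>y j - w\<^sub>l \<bullet> x j\<close>, where the label of the query counts as \<open>0\<close>.
  With \<open>z j\<close> for this column, one layer adds
  \<open>1 / n * (\<Sum>j. (b \<bullet> z j) * (z j \<bullet> (A *\<^sub>v x c)))\<close> to the last entry of column \<open>c\<close>.
  On the other side, \<open>R1\<close> and \<open>R2\<close> are chosen so that \<open>\<nabla>R1\<close> is minus the mean of
  \<open>z j (x j)\<^sup>T\<close> and the last column of \<open>\<nabla>R2\<close> (the only one that enters the update) is
  minus the mean of \<open>(y j - w \<bullet> x j) z j\<close>.  Hence \<open>w\<close> changes by minus the mean of
  \<open>(b \<bullet> z j) A\<^sup>T z j\<close>, and the residuals change as the layer prescribes.
\<close>

section \<open>Columns of the layer output, and partial derivatives of \<open>R1\<close> and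
  \<open>R2\<close>\<close>

text \<open>The label is a separate argument, so that the query column is the instance with label
  0.\<close>

definition token :: "nat \<Rightarrow> real vec \<Rightarrow> real \<Rightarrow> real vec \<Rightarrow> real vec" where
  "token d xj yj w = vec (d + 1) (\<lambda>i. if i < d then xj $ i else yj - w \<bullet> xj)"

lemma dim_token [simp]: "dim_vec (token d xj yj w) = d + 1"
  by (simp add: token_def)

lemma token_index:
  "i < d \<Longrightarrow> token d xj yj w $ i = xj $ i"
  "token d xj yj w $ d = yj - w \<bullet> xj"
  by (simp_all add: token_def)

text \<open>Puts the dependence on t into affine form, so that along one coordinate
  \<open>R1\<close> and \<open>R2\<close> become explicit polynomials in t and the derivative rules
  apply.\<close>

lemma scalar_prod_update_vec:
  fixes w v :: "real vec"
  assumes "v \<in> carrier_vec d" "k < d" "w \<in> carrier_vec d"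
  shows "(w |\<^sub>v k \<mapsto> t) \<bullet> v = (t - w $ k) * v $ k + w \<bullet> v"
proof -
  have "(w |\<^sub>v k \<mapsto> t) \<bullet> v = (\<Sum>i = 0..<d. (w |\<^sub>v k \<mapsto> t) $ i * v $ i)"
    using assms by (simp add: scalar_prod_def)
  also have "\<dots> = (\<Sum>i = 0..<d. (if i = k then (t - w $ k) * v $ k else 0) + w $ i * v $ i)"
    using assms by (intro sum.cong) (auto simp: algebra_simps)
  also have "\<dots> = (t - w $ k) * v $ k + w \<bullet> v"
    using assms by (simp add: sum.distrib scalar_prod_def)
  finally show ?thesis .
qed

lemma scalar_prod_vec_first:
  fixes w v :: "real vec"
  assumes "w \<in> carrier_vec d" "v \<in> carrier_vec d" "d \<ge> 1"
  shows "w \<bullet> v = vec_first w (d - 1) \<bullet> vec_first v (d - 1) + w $ (d - 1) * v $ (d - 1)"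
proof -
  obtain e where "d = Suc e" using assms(3) by (cases d) auto
  then show ?thesis using assms by (simp add: scalar_prod_def vec_first_def)
qed

lemma vec_first_update_vec:
  "k \<ge> m \<Longrightarrow> m \<le> dim_vec w \<Longrightarrow> vec_first (w |\<^sub>v k \<mapsto> t) m = vec_first w m"
  by (intro eq_vecI) (auto simp: vec_first_def)

text \<open>In w the first d components are linear and the last is half a squared residual, so each
  summand of a partial derivative in coordinate k carries a factor \<open>- x j $ k\<close>; what
  remains is entry i of the token.\<close>

lemma jacobian_R1:
  assumes w: "w \<in> carrier_vec d" and x: "\<And>j. j \<in> {1..n} \<Longrightarrow> x j \<in> carrier_vec d"
    and i: "i < d + 1" and k: "k < d"
  shows "jacobian_mat (d + 1) d (R1 d n x y) w $$ (i, k)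
    = - (1 / real n * (\<Sum>j = 1..n. token d (x j) (y j) w $ i * x j $ k))"
proof -
  define f where "f t j = (if i < d then - ((t - w $ k) * x j $ k + w \<bullet> x j) * x j $ i
     else 1 / 2 * (y j - ((t - w $ k) * x j $ k + w \<bullet> x j))\<^sup>2)" for t j
  have R: "R1 d n x y (w |\<^sub>v k \<mapsto> t) $ i = 1 / real n * (\<Sum>j = 1..n. f t j)" for t
  proof -
    have "R1 d n x y (w |\<^sub>v k \<mapsto> t) $ i = 1 / real n * (\<Sum>j = 1..n.
        if i < d then - ((w |\<^sub>v k \<mapsto> t) \<bullet> x j) * x j $ i
        else 1 / 2 * (y j - (w |\<^sub>v k \<mapsto> t) \<bullet> x j)\<^sup>2)"
      using i by (simp add: R1_def)
    also have "\<dots> = 1 / real n * (\<Sum>j = 1..n. f t j)"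
      by (intro arg_cong2[where f = "(*)"] sum.cong)
        (simp_all only: f_def scalar_prod_update_vec[OF x k w])
    finally show ?thesis .
  qed
  have f: "((\<lambda>t. f t j) has_field_derivative - (token d (x j) (y j) w $ i * x j $ k)) (at (w $ k))"
    for j
    using i unfolding f_def
    by (cases "i < d")
      (auto intro!: derivative_eq_intros simp: token_def power2_eq_square algebra_simps)
  have "((\<lambda>t. 1 / real n * (\<Sum>j = 1..n. f t j)) has_field_derivative
      1 / real n * (\<Sum>j = 1..n. - (token d (x j) (y j) w $ i * x j $ k))) (at (w $ k))"
    by (intro DERIV_cmult DERIV_sum f)
  then show ?thesis
    using i k by (simp add: jacobian_mat_def R DERIV_imp_deriv sum_negf)
qed

text \<open>Each component of \<open>R2\<close> is an antiderivative in the last coordinate of w,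
  along which residual j has slope \<open>- x j $ (d - 1)\<close>. Integrating minus the residual
  gives the quadratic; integrating minus its square gives the cube divided by
  \<open>3 * x j $ (d - 1)\<close>. If that entry is 0, the residual is constant along this
  coordinate and the antiderivative is linear.\<close>

lemma jacobian_R2_last_col:
  assumes w: "w \<in> carrier_vec d" and x: "\<And>j. j \<in> {1..n} \<Longrightarrow> x j \<in> carrier_vec d"
    and i: "i < d + 1" and d: "d \<ge> 1"
  shows "jacobian_mat (d + 1) d (R2 d n x y) w $$ (i, d - 1)
    = - (1 / real n * (\<Sum>j = 1..n. token d (x j) (y j) w $ i * (y j - w \<bullet> x j)))"
proof -
  define k where "k = d - 1"
  have k: "k < d" using d by (simp add: k_def)
  define u where "u j = vec_first w k \<bullet> vec_first (x j) k" for j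
  have wx: "w \<bullet> x j = u j + w $ k * x j $ k" if "j \<in> {1..n}" for j
    using scalar_prod_vec_first[OF w x[OF that] d] by (simp add: u_def k_def)
  \<comment> \<open>Only the entry at k is updated, so \<open>u j\<close> is constant in t.\<close>
  have vf: "vec_first (w |\<^sub>v k \<mapsto> t) k = vec_first w k" for t
    using w k by (intro vec_first_update_vec) auto
  have wk: "(w |\<^sub>v k \<mapsto> t) $ k = t" for t
    using w k by simp
  define f where "f t j = (if i < d
     then (- t * (y j - u j) + t\<^sup>2 / 2 * x j $ k) * x j $ i
     else if x j $ k \<noteq> 0
       then 1 / (3 * x j $ k) * (y j - ((t - w $ k) * x j $ k + w \<bullet> x j)) ^ 3
       else - ((y j - u j)\<^sup>2) * t)" for t j
  have R: "R2 d n x y (w |\<^sub>v k \<mapsto> t) $ i = 1 / real n * (\<Sum>j = 1..n. f t j)" for t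
  proof -
    let ?w = "w |\<^sub>v k \<mapsto> t"
    have "R2 d n x y ?w $ i = 1 / real n * (\<Sum>j = 1..n. if i < d
       then (- t * (y j - u j) + t\<^sup>2 / 2 * x j $ k) * x j $ i
       else if x j $ k \<noteq> 0 then 1 / (3 * x j $ k) * (y j - ?w \<bullet> x j) ^ 3
       else - ((y j - u j)\<^sup>2) * t)"
      unfolding R2_def rho_def k_def[symmetric] vf wk u_def using i by simp
    also have "\<dots> = 1 / real n * (\<Sum>j = 1..n. f t j)"
      by (intro arg_cong2[where f = "(*)"] sum.cong)
        (simp_all only: f_def scalar_prod_update_vec[OF x k w])
    finally show ?thesis .
  qed
  have f: "((\<lambda>t. f t j) has_field_derivative
      - (token d (x j) (y j) w $ i * (y j - w \<bullet> x j))) (at (w $ k))"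
    if j: "j \<in> {1..n}" for j
  proof -
    consider "i < d" | "i = d" "x j $ k \<noteq> 0" | "i = d" "x j $ k = 0"
      using i by linarith
    then show ?thesis
    proof cases
      case 1
      then show ?thesis unfolding f_def token_def
        by (auto intro!: derivative_eq_intros simp: wx[OF j] power2_eq_square algebra_simps)
    next
      case 2
      then show ?thesis unfolding f_def token_def
        by (auto intro!: derivative_eq_intros simp: power2_eq_square)
    next
      case 3
      then show ?thesis unfolding f_def token_def
        by (auto intro!: derivative_eq_intros simp: wx[OF j] power2_eq_square)
    qed
  qed
  have "((\<lambda>t. 1 / real n * (\<Sum>j = 1..n. f t j)) has_field_derivative
      1 / real n * (\<Sum>j = 1..n. - (token d (x j) (y j) w $ i * (y j - w \<bullet> x j)))) (at (w $ k))"
    by (intro DERIV_cmult DERIV_sum f)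
  then show ?thesis
    unfolding k_def[symmetric] using i k
    by (simp add: jacobian_mat_def R DERIV_imp_deriv sum_negf)
qed

section \<open>The weight update in terms of tokens\<close>

lemma index_mult_mat_sum:
  assumes "A \<in> carrier_mat r m" "B \<in> carrier_mat m c" "i < r" "j < c"
  shows "(A * B) $$ (i, j) = (\<Sum>k = 0..<m. A $$ (i, k) * B $$ (k, j))"
  using assms by (simp add: scalar_prod_def)

lemma A_mat_carrier:
  "B \<in> carrier_mat d d \<Longrightarrow> v \<in> carrier_vec d \<Longrightarrow> A_mat B v \<in> carrier_mat (d + 1) d"
  unfolding A_mat_def by (intro uminus_carrier_mat carrier_append_rows) auto

lemma A_mat_index:
  assumes "B \<in> carrier_mat d d" "v \<in> carrier_vec d" "i < d + 1" "k < d"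
  shows "A_mat B v $$ (i, k) = - (if i < d then B $$ (i, k) else v $ k)"
  using assms by (auto simp: A_mat_def append_rows_def)

text \<open>Splitting the sum at index d pairs the covariate with B and the residual with v, which
  are the contributions of \<open>R1\<close> and \<open>R2\<close> to the update.\<close>

lemma token_scalar_prod_col_A_mat:
  assumes "B \<in> carrier_mat d d" "v \<in> carrier_vec d" "k < d"
  shows "token d xj yj w \<bullet> col (A_mat B v) k
    = - ((\<Sum>m = 0..<d. xj $ m * B $$ (m, k)) + (yj - w \<bullet> xj) * v $ k)"
  using assms A_mat_carrier[OF assms(1,2)]
  by (simp add: scalar_prod_def token_index A_mat_index sum_negf)

text \<open>The zero rows cancel every column of J except the last; hence only that column of the
  Jacobian of \<open>R2\<close> has to be computed.\<close>

lemma index_mult_last_row: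
  fixes J :: "real mat"
  assumes "J \<in> carrier_mat r d" "v \<in> carrier_vec d" "d \<ge> 1" "i < r" "k < d"
  shows "(J * (0\<^sub>m (d - 1) d @\<^sub>r mat_of_row v)) $$ (i, k) = J $$ (i, d - 1) * v $ k"
proof -
  obtain e where e: "d = Suc e" using assms(3) by (cases d) auto
  show ?thesis
    using assms by (simp add: e append_rows_def scalar_prod_def)
qed

lemma weights_carrier:
  "weights d n x y b Abar a 0 \<in> carrier_vec d"
  "Abar l \<in> carrier_mat d d \<Longrightarrow> a l \<in> carrier_vec d \<Longrightarrow> d \<ge> 1
     \<Longrightarrow> weights d n x y b Abar a (Suc l) \<in> carrier_vec d"
  by (auto intro!: carrier_vecI simp: Let_def append_rows_def)

text \<open>Both Jacobian terms are means over j with the token as common factor. Their cofactors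
  add up to minus the scalar product of the token with a column of A, and contracting with b turns
  the token into \<open>b l \<bullet> token d (x j) (y j) w\<close>.\<close>

lemma weights_Suc_index:
  assumes w_def: "w = weights d n x y b Abar a l" and d: "d \<ge> 1" and w: "w \<in> carrier_vec d"
    and x: "\<And>j. j \<in> {1..n} \<Longrightarrow> x j \<in> carrier_vec d"
    and b: "b l \<in> carrier_vec (d + 1)" and B: "Abar l \<in> carrier_mat d d"
    and a: "a l \<in> carrier_vec d" and k: "k < d"
  shows "weights d n x y b Abar a (Suc l) $ k = w $ k - 1 / real n *
    (\<Sum>j = 1..n. (b l \<bullet> token d (x j) (y j) w) *
                 (token d (x j) (y j) w \<bullet> col (A_mat (Abar l) (a l)) k))"
proof -
  define J1 where "J1 = jacobian_mat (d + 1) d (R1 d n x y) w"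
  define J2 where "J2 = jacobian_mat (d + 1) d (R2 d n x y) w"
  let ?E = "0\<^sub>m (d - 1) d @\<^sub>r mat_of_row (a l)"
  let ?z = "\<lambda>j. token d (x j) (y j) w"
  let ?c = "\<lambda>j. ?z j \<bullet> col (A_mat (Abar l) (a l)) k"
  have J1: "J1 \<in> carrier_mat (d + 1) d"
    and J2: "J2 \<in> carrier_mat (d + 1) d"
    by (simp_all add: J1_def J2_def jacobian_mat_def)
  \<comment> \<open>The stacked matrix has \<open>d - 1 + 1\<close> rows, which is d because
    \<open>d \<ge> 1\<close>.\<close>
  have E: "?E \<in> carrier_mat d d"
    using carrier_append_rows[of "0\<^sub>m (d - 1) d :: real mat" "d - 1" d "mat_of_row (a l)" 1] a d
    by simp
  \<comment> \<open>The minus sign shared by the two Jacobian formulas is absorbed by the one inside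
    \<open>A_mat\<close>.\<close>
  have G: "(J1 * Abar l + J2 * ?E) $$ (i, k) = 1 / real n * (\<Sum>j = 1..n. ?z j $ i * ?c j)"
    if i: "i < d + 1" for i
  proof -
    have J1i: "J1 $$ (i, m) * Abar l $$ (m, k)
        = - (1 / real n * (\<Sum>j = 1..n. ?z j $ i * x j $ m * Abar l $$ (m, k)))"
      if "m \<in> {0..<d}" for m
    proof -
      have "m < d" using that by simp
      from jacobian_R1[where x = x and n = n and y = y, OF w x i this, folded J1_def] show ?thesis
        by (simp add: sum_distrib_right)
    qed
    have J2i: "J2 $$ (i, d - 1) = - (1 / real n * (\<Sum>j = 1..n. ?z j $ i * (y j - w \<bullet> x j)))"
      unfolding J2_def by (rule jacobian_R2_last_col[OF w x i d])
    have "(J1 * Abar l + J2 * ?E) $$ (i, k) = (J1 * Abar l) $$ (i, k) + (J2 * ?E) $$ (i, k)"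
      using J1 J2 E B i k by (intro index_add_mat) auto
    also have "(J2 * ?E) $$ (i, k) = J2 $$ (i, d - 1) * a l $ k"
      by (rule index_mult_last_row[OF J2 a d i k])
    also have "(J1 * Abar l) $$ (i, k) = (\<Sum>m = 0..<d. J1 $$ (i, m) * Abar l $$ (m, k))"
      by (rule index_mult_mat_sum[OF J1 B i k])
    also have "(\<Sum>m = 0..<d. J1 $$ (i, m) * Abar l $$ (m, k))
        = - (1 / real n * (\<Sum>m = 0..<d. \<Sum>j = 1..n. ?z j $ i * x j $ m * Abar l $$ (m, k)))"
      by (simp only: sum.cong[OF refl J1i] sum_negf sum_distrib_left)
    also have "(\<Sum>m = 0..<d. \<Sum>j = 1..n. ?z j $ i * x j $ m * Abar l $$ (m, k))
        = (\<Sum>j = 1..n. ?z j $ i * (\<Sum>m = 0..<d. x j $ m * Abar l $$ (m, k)))"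
      by (subst sum.swap) (simp add: sum_distrib_left mult.assoc)
    also have "J2 $$ (i, d - 1) * a l $ k
        = - (1 / real n * (\<Sum>j = 1..n. ?z j $ i * ((y j - w \<bullet> x j) * a l $ k)))"
      by (simp add: J2i sum_distrib_left sum_distrib_right mult.assoc del: One_nat_def)
    finally show ?thesis
      by (simp only: token_scalar_prod_col_A_mat[OF B a k] distrib_left sum.distrib sum_negf
          mult_minus_right minus_add_distrib)
  qed
  have "weights d n x y b Abar a (Suc l) $ k
      = w $ k - (\<Sum>i = 0..<d + 1. b l $ i * (J1 * Abar l + J2 * ?E) $$ (i, k))"
    using w b J1 J2 E B k
    unfolding weights.simps w_def[symmetric] J1_def[symmetric] J2_def[symmetric] Let_def
    by (simp add: scalar_prod_def[of "row _ _"] del: index_add_mat(1) index_mult_mat(1))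
      (simp add: scalar_prod_def del: index_add_mat(1))
  also have "(\<Sum>i = 0..<d + 1. b l $ i * (J1 * Abar l + J2 * ?E) $$ (i, k))
      = 1 / real n * (\<Sum>i = 0..<d + 1. \<Sum>j = 1..n. b l $ i * ?z j $ i * ?c j)"
  proof -
    have "b l $ i * (J1 * Abar l + J2 * ?E) $$ (i, k)
        = 1 / real n * (\<Sum>j = 1..n. b l $ i * ?z j $ i * ?c j)" if "i \<in> {0..<d + 1}" for i
    proof -
      have "i < d + 1" using that by simp
      from G[OF this] show ?thesis
        by (simp only: sum_distrib_left mult.assoc mult.left_commute)
    qed
    then show ?thesis
      by (simp only: sum_distrib_left[of "1 / real n"] cong: sum.cong)
  qed
  also have "(\<Sum>i = 0..<d + 1. \<Sum>j = 1..n. b l $ i * ?z j $ i * ?c j)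
      = (\<Sum>j = 1..n. (b l \<bullet> ?z j) * ?c j)"
    by (subst sum.swap) (simp add: scalar_prod_def[of "b l"] sum_distrib_right del: sum.op_ivl_Suc)
  finally show ?thesis .
qed

text \<open>The vector v is arbitrary because the same update is evaluated at every example and at
  the query. Coordinate k of the update is weighted by \<open>v $ k\<close> and summed.\<close>

lemma weights_Suc_scalar_prod:
  assumes w_def: "w = weights d n x y b Abar a l" and d: "d \<ge> 1" and w: "w \<in> carrier_vec d"
    and x: "\<And>j. j \<in> {1..n} \<Longrightarrow> x j \<in> carrier_vec d"
    and b: "b l \<in> carrier_vec (d + 1)" and B: "Abar l \<in> carrier_mat d d"
    and a: "a l \<in> carrier_vec d" and v: "v \<in> carrier_vec d"
  shows "weights d n x y b Abar a (Suc l) \<bullet> v = w \<bullet> v - 1 / real n *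
    (\<Sum>j = 1..n. (b l \<bullet> token d (x j) (y j) w) *
                 (token d (x j) (y j) w \<bullet> (A_mat (Abar l) (a l) *\<^sub>v v)))"
proof -
  let ?z = "\<lambda>j. token d (x j) (y j) w"
  let ?A = "A_mat (Abar l) (a l)"
  note A = A_mat_carrier[OF B a]
  have zA: "?z j \<bullet> (?A *\<^sub>v v) = (\<Sum>k = 0..<d. (?z j \<bullet> col ?A k) * v $ k)" for j
  proof -
    have "?z j \<bullet> (?A *\<^sub>v v) = (\<Sum>i = 0..<d + 1. \<Sum>k = 0..<d. ?z j $ i * ?A $$ (i, k) * v $ k)"
      using A v by (simp add: scalar_prod_def sum_distrib_left mult.assoc del: sum.op_ivl_Suc)
    also have "\<dots> = (\<Sum>k = 0..<d. (?z j \<bullet> col ?A k) * v $ k)"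
      using A by (subst sum.swap)
        (simp add: scalar_prod_def sum_distrib_right del: sum.op_ivl_Suc)
    finally show ?thesis .
  qed
  have "weights d n x y b Abar a (Suc l) \<bullet> v
      = (\<Sum>k = 0..<d. weights d n x y b Abar a (Suc l) $ k * v $ k)"
    using v by (simp add: scalar_prod_def del: weights.simps)
  also have "\<dots> = (\<Sum>k = 0..<d. w $ k * v $ k) - 1 / real n *
      (\<Sum>k = 0..<d. \<Sum>j = 1..n. (b l \<bullet> ?z j) * ((?z j \<bullet> col ?A k) * v $ k))"
    using weights_Suc_index[OF w_def d w x b B a]
    by (simp add: left_diff_distrib sum_subtractf sum_distrib_left sum_distrib_right mult.assoc
        del: weights.simps cong: sum.cong_simp)
  also have "(\<Sum>k = 0..<d. \<Sum>j = 1..n. (b l \<bullet> ?z j) * ((?z j \<bullet> col ?A k) * v $ k))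
      = (\<Sum>j = 1..n. (b l \<bullet> ?z j) * (?z j \<bullet> (?A *\<^sub>v v)))"
    by (subst sum.swap) (simp add: zA sum_distrib_left)
  also have "(\<Sum>k = 0..<d. w $ k * v $ k) = w \<bullet> v"
    using v by (simp add: scalar_prod_def)
  finally show ?thesis .
qed

section \<open>The effect of one layer on the entries\<close>

text \<open>P has only a bottom row, and the mask annihilates the query column, so the query is
  never a summand of the attention sum.\<close>

lemma P_mat_mult_mask_index:
  assumes b: "b \<in> carrier_vec (d + 1)" and Z: "Z \<in> carrier_mat (d + 1) (n + 1)"
    and i: "i < d + 1" and j: "j < n + 1"
  shows "(P_mat d b * Z * mask n) $$ (i, j) = (if i = d \<and> j < n then b \<bullet> col Z j else 0)"
proof -
  have P: "P_mat d b \<in> carrier_mat (d + 1) (d + 1)"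
    unfolding P_mat_def using b by (intro carrier_append_rows) auto
  have rowP: "row (P_mat d b) i = (if i = d then b else 0\<^sub>v (d + 1))"
    using b i by (intro eq_vecI) (auto simp: P_mat_def append_rows_def)
  have M: "mask n \<in> carrier_mat (n + 1) (n + 1)"
    by (intro carrier_matI) (simp_all add: mask_def)
  have colM: "col (mask n) j = (if j < n then unit_vec (n + 1) j else 0\<^sub>v (n + 1))"
    using j by (intro eq_vecI) (auto simp: mask_def)
  have "(P_mat d b * Z * mask n) $$ (i, j) = row (P_mat d b * Z) i \<bullet> col (mask n) j"
    by (rule index_mult_mat) (use P Z M i j in auto)
  also have "\<dots> = (if j < n then (P_mat d b * Z) $$ (i, j) else 0)"
    unfolding colM using P Z i j by auto
  also have "\<dots> = (if i = d \<and> j < n then b \<bullet> col Z j else 0)"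
    using P Z i j rowP by auto
  finally show ?thesis .
qed

text \<open>The last column of Q is zero, so a column of Z may be replaced by its covariate.\<close>

lemma Q_mat_mult_vec:
  assumes B: "B \<in> carrier_mat d d" and a: "a \<in> carrier_vec d" and z: "z \<in> carrier_vec (d + 1)"
    and v: "v \<in> carrier_vec d" and zv: "\<And>i. i < d \<Longrightarrow> z $ i = v $ i"
  shows "Q_mat d B a *\<^sub>v z = A_mat B a *\<^sub>v v"
proof -
  note A = A_mat_carrier[OF B a]
  show ?thesis
    using A z v by (intro eq_vecI) (simp_all add: Q_mat_def scalar_prod_def zv)
qed

text \<open>The left factor supplies \<open>b \<bullet> col Z j\<close> for the examples only, the
  right factor the bilinear score of column j against the covariate of column c. Rows above the last
  are unchanged, so covariates persist through all layers.\<close>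

lemma transformer_step_index:
  assumes b: "b \<in> carrier_vec (d + 1)" and Z: "Z \<in> carrier_mat (d + 1) (n + 1)"
    and B: "B \<in> carrier_mat d d" and a: "a \<in> carrier_vec d"
    and i: "i < d + 1" and c: "c < n + 1"
    and v: "v \<in> carrier_vec d" and zv: "\<And>i. i < d \<Longrightarrow> Z $$ (i, c) = v $ i"
  shows "(Z + (1 / real n) \<cdot>\<^sub>m (P_mat d b * Z * mask n * (Z\<^sup>T * Q_mat d B a * Z))) $$ (i, c)
    = Z $$ (i, c) + (if i = d
        then 1 / real n * (\<Sum>j = 0..<n. (b \<bullet> col Z j) * (col Z j \<bullet> (A_mat B a *\<^sub>v v))) else 0)"
proof -
  let ?L = "P_mat d b * Z * mask n" and ?K = "Z\<^sup>T * Q_mat d B a * Z"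
  note A = A_mat_carrier[OF B a]
  have L: "?L \<in> carrier_mat (d + 1) (n + 1)"
    using b by (intro carrier_matI) (simp_all add: P_mat_def mask_def append_rows_def)
  have Q: "Q_mat d B a \<in> carrier_mat (d + 1) (d + 1)"
    using A by (intro carrier_matI) (simp_all add: Q_mat_def)
  have K: "?K \<in> carrier_mat (n + 1) (n + 1)"
    using Z by (intro carrier_matI) simp_all
  have Kj: "?K $$ (j, c) = col Z j \<bullet> (A_mat B a *\<^sub>v v)" if j: "j < n + 1" for j
  proof -
    \<comment> \<open>Reassociated so that column c of the product is Q applied to column c of
      Z.\<close>
    have "?K = Z\<^sup>T * (Q_mat d B a * Z)"
      using Z Q by (intro assoc_mult_mat) auto
    then have "?K $$ (j, c) = col Z j \<bullet> (Q_mat d B a *\<^sub>v col Z c)"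
      using Z Q j c by (simp add: col_mult2[OF Q Z])
    also have "Q_mat d B a *\<^sub>v col Z c = A_mat B a *\<^sub>v v"
      using Z c zv by (intro Q_mat_mult_vec B a v) auto
    finally show ?thesis .
  qed
  have "(?L * ?K) $$ (i, c) = (\<Sum>j = 0..<n + 1. ?L $$ (i, j) * ?K $$ (j, c))"
    by (rule index_mult_mat_sum[OF L K i c])
  also have "\<dots> = (\<Sum>j = 0..<n + 1. (if i = d \<and> j < n then b \<bullet> col Z j else 0)
      * (col Z j \<bullet> (A_mat B a *\<^sub>v v)))"
    by (intro sum.cong) (simp_all only: P_mat_mult_mask_index[OF b Z i] Kj atLeastLessThan_iff)
  also have "\<dots> = (if i = d
      then (\<Sum>j = 0..<n. (b \<bullet> col Z j) * (col Z j \<bullet> (A_mat B a *\<^sub>v v))) else 0)"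
    by simp
  finally show ?thesis
    using Z i c by (simp add: P_mat_def append_rows_def b del: index_mult_mat(1))
qed

section \<open>Induction over the layers\<close>

lemma transformer_carrier:
  "transformer d n x y b Abar a l \<in> carrier_mat (d + 1) (n + 1)"
  by (induction l)
    (auto intro!: carrier_matI simp: prompt_def Let_def P_mat_def append_rows_def)

text \<open>The query column alone does not carry the induction: its update reads every example
  column, so the invariant covers all columns. The carrier part provides the dimension of w that the
  update lemmas require.\<close>

lemma transformer_eq_tokens:
  assumes d: "d \<ge> 1"
    and x: "\<And>j. j \<in> {1..n + 1} \<Longrightarrow> x j \<in> carrier_vec d"
    and b: "\<And>l. l < L \<Longrightarrow> b l \<in> carrier_vec (d + 1)"
    and B: "\<And>l. l < L \<Longrightarrow> Abar l \<in> carrier_mat d d"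
    and a: "\<And>l. l < L \<Longrightarrow> a l \<in> carrier_vec d"
    and l: "l \<le> L"
  shows "weights d n x y b Abar a l \<in> carrier_vec d \<and>
    (\<forall>c < n + 1. col (transformer d n x y b Abar a l) c
       = token d (x (c + 1)) (if c < n then y (c + 1) else 0) (weights d n x y b Abar a l))"
  using l
proof (induction l)
  case 0
  \<comment> \<open>At zero weights the residual is the label itself, which matches the last row of
    the prompt.\<close>
  have "0\<^sub>v d \<bullet> x (c + 1) = 0" if "c < n + 1" for c
    using x[of "c + 1"] that by simp
  then show ?case
    by (auto intro!: eq_vecI simp: prompt_def token_def)
next
  case (Suc l)
  define w where "w = weights d n x y b Abar a l"
  define Z where "Z = transformer d n x y b Abar a l"
  let ?A = "A_mat (Abar l) (a l)"
  let ?z = "\<lambda>c. token d (x (c + 1)) (if c < n then y (c + 1) else 0) w"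
  have lL: "l < L" using Suc.prems by simp
  have w: "w \<in> carrier_vec d" and col: "\<And>c. c < n + 1 \<Longrightarrow> col Z c = ?z c"
    using Suc.IH lL by (auto simp: w_def Z_def)
  have Z: "Z \<in> carrier_mat (d + 1) (n + 1)"
    unfolding Z_def by (rule transformer_carrier)
  have Zi: "Z $$ (i, c) = ?z c $ i" if "i < d + 1" "c < n + 1" for i c
    using col[OF that(2)] Z that by (metis carrier_matD index_col)
  have "transformer d n x y b Abar a (Suc l) $$ (i, c)
      = token d (x (c + 1)) (if c < n then y (c + 1) else 0)
          (weights d n x y b Abar a (Suc l)) $ i"
    if i: "i < d + 1" and c: "c < n + 1" for i c
  proof -
    have xc: "x (c + 1) \<in> carrier_vec d" using x c by simp
    let ?s = "1 / real n * (\<Sum>j = 1..n. (b l \<bullet> token d (x j) (y j) w) *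
        (token d (x j) (y j) w \<bullet> (?A *\<^sub>v x (c + 1))))"
    \<comment> \<open>Columns count from 0 and examples from 1, hence the index shift.\<close>
    have "(\<Sum>j = 0..<n. (b l \<bullet> col Z j) * (col Z j \<bullet> (?A *\<^sub>v x (c + 1))))
        = (\<Sum>j = 0..<n. (b l \<bullet> token d (x (Suc j)) (y (Suc j)) w) *
            (token d (x (Suc j)) (y (Suc j)) w \<bullet> (?A *\<^sub>v x (c + 1))))"
      by (intro sum.cong) (simp_all add: col)
    also have "\<dots> = (\<Sum>j = 1..n. (b l \<bullet> token d (x j) (y j) w) *
        (token d (x j) (y j) w \<bullet> (?A *\<^sub>v x (c + 1))))"
      using sum.shift_bounds_Suc_ivl[of "\<lambda>j. (b l \<bullet> token d (x j) (y j) w) *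
        (token d (x j) (y j) w \<bullet> (?A *\<^sub>v x (c + 1)))" 0 n]
      by (simp only: atLeastLessThanSuc_atLeastAtMost One_nat_def)
    finally have "transformer d n x y b Abar a (Suc l) $$ (i, c)
        = ?z c $ i + (if i = d then ?s else 0)"
      using transformer_step_index[OF b[OF lL] Z B[OF lL] a[OF lL] i c xc] Zi i c
      by (simp add: Z_def[symmetric] Let_def token_index)
    \<comment> \<open>The layer adds \<open>?s\<close> to the last entry while the scalar product
      drops by \<open>?s\<close>; the label is fixed, so the residual form survives.\<close>
    moreover have "weights d n x y b Abar a (Suc l) \<bullet> x (c + 1) = w \<bullet> x (c + 1) - ?s"
      by (rule weights_Suc_scalar_prod[OF w_def d w _ b[OF lL] B[OF lL] a[OF lL] xc])
        (simp add: x)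
    ultimately show ?thesis
      using i by (simp add: token_def del: transformer.simps weights.simps)
  qed
  moreover have "weights d n x y b Abar a (Suc l) \<in> carrier_vec d"
    using weights_carrier(2) B[OF lL] a[OF lL] d by blast
  ultimately show ?case
    using transformer_carrier[of d n x y b Abar a "Suc l"]
    by (auto intro!: eq_vecI simp del: transformer.simps weights.simps)
qed

theorem theorem4p1:
  fixes d n L :: nat and S :: "real set"
    and x :: "nat \<Rightarrow> real vec" and y :: "nat \<Rightarrow> real"
    and b :: "nat \<Rightarrow> real vec" and Abar :: "nat \<Rightarrow> real mat" and a :: "nat \<Rightarrow> real vec"
  assumes "d \<ge> 1" and "n \<ge> 1" and "L \<ge> 1"
    and "finite S"
    and "\<And>j. j \<in> {1..n + 1} \<Longrightarrow> x j \<in> carrier_vec d \<and> set\<^sub>v (x j) \<subseteq> S"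
    and "\<And>j. j \<in> {1..n} \<Longrightarrow> y j \<in> S"
    and "\<And>l. l < L \<Longrightarrow> b l \<in> carrier_vec (d + 1)"
    and "\<And>l. l < L \<Longrightarrow> Abar l \<in> carrier_mat d d"
    and "\<And>l. l < L \<Longrightarrow> a l \<in> carrier_vec d"
  shows "\<forall>l \<le> L. transformer d n x y b Abar a l $$ (d, n)
                 = - (weights d n x y b Abar a l \<bullet> x (n + 1))"
proof (intro allI impI)
  fix l assume l: "l \<le> L"
  have x: "\<And>j. j \<in> {1..n + 1} \<Longrightarrow> x j \<in> carrier_vec d" using assms(5) by blast
  have "transformer d n x y b Abar a l $$ (d, n) = col (transformer d n x y b Abar a l) n $ d"
    using transformer_carrier[of d n x y b Abar a l] by simp
  \<comment> \<open>With label 0 the residual is minus the prediction, which is where the sign in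
    the conclusion comes from.\<close>
  also have "\<dots> = token d (x (n + 1)) 0 (weights d n x y b Abar a l) $ d"
    using transformer_eq_tokens[OF assms(1) x assms(7-9) l, where n = n and y = y] by simp
  finally show "transformer d n x y b Abar a l $$ (d, n)
      = - (weights d n x y b Abar a l \<bullet> x (n + 1))"
    by (simp add: token_index)
qed

end
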